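(* Let $\mathbf P=\{\mathbf p_1,\mathbf p_2,\mathbf p_3,\mathbf p_4\}\subseteq\mathbb{Q}^2$ be a set of four non-zero vectors, not all parallel and no two equal or opposite. Then $\mathbf P$ satisfies the Lonely Vector Property.
   Context: For $\mathbf P=\{\mathbf p_1,\dots,\mathbf p_n\}\subseteq\mathbb{R}^2$ let $S_{\mathbf P}$ be the multiset of cardinality $n^2$ given by $$S_{\mathbf P}=\mathbf P\cup\{\mathbf p_i+\mathbf p_j:1\le i<j\le n\}\cup\{\mathbf p_i-\mathbf p_j:1\le i<j\le n\}.$$ $\mathbf P$ satisfies the Lonely Vector Property (LVP) if $S_{\mathbf P}$ contains a vector that is not parallel to any other vector in the multiset $S_{\mathbf P}$. *)

theory Defs
  imports "HOL-Analysis.Analysis" "HOL-Library.Multiset"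
begin

text \<open>
  The zero vector counts as parallel to every vector.
\<close>

definition parallel :: "real^2 \<Rightarrow> real^2 \<Rightarrow> bool" where
  "parallel u v \<longleftrightarrow> (\<exists>c. u = c *\<^sub>R v) \<or> (\<exists>c. v = c *\<^sub>R u)"

lemma parallel_iff_collinear: "parallel u v \<longleftrightarrow> collinear {0, u, v}"
proof -
  have "\<exists>d. v = d *\<^sub>R u" if "u = c *\<^sub>R v" "u \<noteq> 0" for c
    using that by (intro exI[of _ "inverse c"]) auto
  moreover have "\<exists>c. 0 = c *\<^sub>R v" "\<exists>c. 0 = c *\<^sub>R u"
    by (auto intro: exI[of _ 0])
  ultimately show ?thesis
    unfolding parallel_def collinear_lemma by blast
qed

text \<open>
  The vectors \<open>p\<^sub>1, \<dots>, p\<^sub>n\<close> are given as a family \<open>p\<close>, of which only the values at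
  \<open>1, \<dots>, n\<close> matter. The union in the definition of \<open>S\<^sub>P\<close> adds multiplicities, so that
  the multiset has cardinality \<open>n\<^sup>2\<close>.
\<close>

definition index_pairs :: "nat \<Rightarrow> (nat \<times> nat) set" where
  "index_pairs n = {(i, j). 1 \<le> i \<and> i < j \<and> j \<le> n}"

definition S_multiset :: "nat \<Rightarrow> (nat \<Rightarrow> real^2) \<Rightarrow> (real^2) multiset" where
  "S_multiset n p =
     image_mset p (mset_set {1..n})
     + image_mset (\<lambda>(i, j). p i + p j) (mset_set (index_pairs n))
     + image_mset (\<lambda>(i, j). p i - p j) (mset_set (index_pairs n))"

text \<open>
  Removing one copy of \<open>v\<close> leaves exactly the other members of the multiset; a vector
  occurring twice is thus parallel to another member.
\<close>

definition lonely_vector_property :: "nat \<Rightarrow> (nat \<Rightarrow> real^2) \<Rightarrow> bool" where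
  "lonely_vector_property n p \<longleftrightarrow>
     (\<exists>v \<in># S_multiset n p. \<forall>w \<in># S_multiset n p - {#v#}. \<not> parallel v w)"

lemma card_index_pairs: "2 * card (index_pairs n) + n = n\<^sup>2"
proof (induction n)
  case 0
  have "index_pairs 0 = {}" by (auto simp: index_pairs_def)
  then show ?case by simp
next
  case (Suc n)
  have fin: "finite (index_pairs n)"
    by (rule finite_subset[of _ "{..n} \<times> {..n}"]) (auto simp: index_pairs_def)
  have eq: "index_pairs (Suc n) = index_pairs n \<union> (\<lambda>i. (i, Suc n)) ` {1..n}"
    by (auto simp: index_pairs_def image_iff)
  have "card (index_pairs (Suc n)) = card (index_pairs n) + card ((\<lambda>i. (i, Suc n)) ` {1..n})"
    unfolding eq by (rule card_Un_disjoint) (auto simp: fin, auto simp: index_pairs_def)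
  also have "card ((\<lambda>i. (i, Suc n)) ` {1..n}) = n"
    by (subst card_image) (auto simp: inj_on_def)
  finally show ?case using Suc.IH by (simp add: power2_eq_square)
qed

lemma size_S_multiset: "size (S_multiset n p) = n\<^sup>2"
  using card_index_pairs[of n] by (simp add: S_multiset_def)

end

(*
  If no vector is lonely, the 16 vectors span at most 8 lines. They span at least 8: if the
  p_i are pairwise non-parallel, replace them by +-p_i and reorder so that all determinants
  det(p_i, p_j), i < j, are positive; then p1, p1 + p2, p2, p2 + p3, p3, p3 + p4, p4, p4 - p1
  are sorted by angle. Hence each of these is parallel to exactly one of the other
  8 vectors, and each of those to exactly one of these. This forces p1 + p2 to be parallel to
  p3 - p4 and p1 to p2 - p4. The situation is invariant under the rotation
  (p1, p2, p3, p4) -> (p2, p3, p4, -p1), so all consecutive determinants equal some x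
  and both det(p1, p3) and det(p2, p4) equal some y. The Pluecker relation becomes
  y^2 = 2 x^2 (the eight points +-p_i form an affinely regular octagon), impossible over
  the rationals. If two of the p_i are parallel, an extremality argument gives a lonely vector
  even over the reals.
*)

theory Submission
  imports Defs
begin

section \<open>Determinants and parallelism in the plane\<close>

definition det2 :: "real^2 \<Rightarrow> real^2 \<Rightarrow> real" where
  "det2 u v = u $ 1 * v $ 2 - u $ 2 * v $ 1"

lemma det2_simps [simp]:
  "det2 u u = 0"
  "det2 0 v = 0" "det2 u 0 = 0"
  "det2 (u + u') v = det2 u v + det2 u' v"
  "det2 (u - u') v = det2 u v - det2 u' v"
  "det2 u (v + v') = det2 u v + det2 u v'"
  "det2 u (v - v') = det2 u v - det2 u v'"
  "det2 (- u) v = - det2 u v"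
  "det2 u (- v) = - det2 u v"
  "det2 (k *\<^sub>R u) v = k * det2 u v"
  "det2 u (k *\<^sub>R v) = k * det2 u v"
  by (simp_all add: det2_def algebra_simps)

lemma det2_commute: "det2 v u = - det2 u v" for u v
  by (simp add: det2_def)

lemma det2_Pluecker:
  "det2 a b * det2 c d - det2 a c * det2 b d + det2 a d * det2 b c = 0"
  by (simp add: det2_def algebra_simps)

lemma det2_eq_0_imp_scaleR:
  assumes "det2 u v = 0" "u \<noteq> 0"
  obtains k where "v = k *\<^sub>R u"
proof (cases "u $ 1 = 0")
  case True
  then have u2: "u $ 2 \<noteq> 0"
    using assms(2) by (auto simp: vec_eq_iff forall_2)
  have "v = (v $ 2 / u $ 2) *\<^sub>R u"
    using assms(1) True u2 by (auto simp: vec_eq_iff forall_2 det2_def)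
  then show ?thesis by (rule that)
next
  case False
  have "v = (v $ 1 / u $ 1) *\<^sub>R u"
    using assms(1) False by (auto simp: vec_eq_iff forall_2 det2_def field_simps)
  then show ?thesis by (rule that)
qed

lemma parallel_iff_det2: "parallel u v \<longleftrightarrow> det2 u v = 0"
proof
  show "det2 u v = 0" if "parallel u v"
    using that by (auto simp: parallel_def)
  show "parallel u v" if "det2 u v = 0"
  proof (cases "u = 0")
    case True
    then have "u = 0 *\<^sub>R v" by simp
    then show ?thesis unfolding parallel_def by blast
  next
    case False
    then show ?thesis
      using that by (metis det2_eq_0_imp_scaleR parallel_def)
  qed
qed

lemma det2_eq_0_trans:
  assumes "det2 u v = 0" "det2 v w = 0" "v \<noteq> 0"
  shows "det2 u w = 0"
proof -
  obtain k where "w = k *\<^sub>R v" using det2_eq_0_imp_scaleR[OF assms(2,3)] .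
  then show ?thesis using assms(1) by simp
qed

section \<open>Spanned lines and their invariance under signed permutations\<close>

definition line_of :: "real^2 \<Rightarrow> (real^2) set" where
  "line_of v = {w. det2 v w = 0}"

lemma line_of_minus [simp]: "line_of (- v) = line_of v"
  by (simp add: line_of_def)

lemma line_of_minus_commute: "line_of (u - v) = line_of (v - u)"
  using line_of_minus[of "v - u"] by simp

lemma line_of_eqD: "line_of u = line_of v \<Longrightarrow> det2 u v = 0"
  by (auto simp: line_of_def set_eq_iff)

text \<open>Zero vectors are excluded because \<open>line_of 0\<close> is the whole plane.\<close>

lemma line_of_eqI: "det2 u v = 0 \<Longrightarrow> u \<noteq> 0 \<Longrightarrow> v \<noteq> 0 \<Longrightarrow> line_of u = line_of v"
  unfolding line_of_def using det2_eq_0_trans det2_commute by (metis neg_equal_0_iff_equal)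

definition vectors :: "real^2 \<Rightarrow> real^2 \<Rightarrow> real^2 \<Rightarrow> real^2 \<Rightarrow> (real^2) multiset" where
  "vectors a b c d = {#a, b, c, d, a + b, a + c, a + d, b + c, b + d, c + d,
     a - b, a - c, a - d, b - c, b - d, c - d#}"

text \<open>
  Passing to spanned lines makes the signed permutations of \<open>a, b, c, d\<close> act trivially.
  For nonzero vectors, a lonely vector is one whose line has multiplicity one.
\<close>

definition lines :: "real^2 \<Rightarrow> real^2 \<Rightarrow> real^2 \<Rightarrow> real^2 \<Rightarrow> (real^2) set multiset" where
  "lines a b c d = image_mset line_of (vectors a b c d)"

lemma lines_swap12: "lines b a c d = lines a b c d"
  by (simp add: lines_def vectors_def line_of_minus_commute[of b a] add.commute[of b a])

lemma lines_swap23: "lines a c b d = lines a b c d"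
  by (simp add: lines_def vectors_def line_of_minus_commute[of c b] add.commute[of c b])

lemma lines_swap34: "lines a b d c = lines a b c d"
  by (simp add: lines_def vectors_def line_of_minus_commute[of d c] add.commute[of d c])

text \<open>Up to sign, negating \<open>a\<close> exchanges \<open>a + v\<close> and
  \<open>a - v\<close>, which only permutes the multiset.\<close>

lemma lines_minus1: "lines (- a) b c d = lines a b c d"
proof -
  have "line_of (- a + v) = line_of (a - v)" "line_of (- a - v) = line_of (a + v)" for v
    using line_of_minus[of "a - v"] line_of_minus[of "a + v"] by simp_all
  then show ?thesis
    unfolding lines_def vectors_def by simp
qed

definition unlonely :: "real^2 \<Rightarrow> real^2 \<Rightarrow> real^2 \<Rightarrow> real^2 \<Rightarrow> bool" where
  "unlonely a b c d \<longleftrightarrow> (\<forall>L \<in># lines a b c d. L \<in># lines a b c d - {#L#})"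

lemma unlonely_swap12: "unlonely b a c d = unlonely a b c d"
  and unlonely_swap23: "unlonely a c b d = unlonely a b c d"
  and unlonely_swap34: "unlonely a b d c = unlonely a b c d"
  and unlonely_minus1: "unlonely (- a) b c d = unlonely a b c d"
  using lines_swap12[of b a c d] lines_swap23[of a c b d] lines_swap34[of a b d c]
    lines_minus1[of a b c d]
  unfolding unlonely_def by metis+

lemma unlonely_minus2: "unlonely a (- b) c d = unlonely a b c d"
  by (metis unlonely_minus1 unlonely_swap12)

lemma unlonely_minus3: "unlonely a b (- c) d = unlonely a b c d"
  by (metis unlonely_minus2 unlonely_swap23)

lemma unlonely_minus4: "unlonely a b c (- d) = unlonely a b c d"
  by (metis unlonely_minus3 unlonely_swap34)

lemma unlonely_rotate: "unlonely b c d (- a) = unlonely a b c d"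
  by (metis unlonely_minus4 unlonely_swap12 unlonely_swap23 unlonely_swap34)

text \<open>It suffices to list the candidate partners of \<open>a\<close> here and of
  \<open>a + b\<close> below: signed permutations carry these two vectors to all sixteen, up to
  sign.\<close>

lemma unlonely_single:
  assumes "unlonely a b c d"
  shows "\<exists>v \<in> {b, c, d, a + b, a + c, a + d, b + c, b + d, c + d,
     a - b, a - c, a - d, b - c, b - d, c - d}. det2 a v = 0"
proof -
  have "line_of a \<in># lines a b c d - {#line_of a#}"
    using assms by (simp add: unlonely_def lines_def vectors_def)
  then have "line_of a \<in> line_of ` {b, c, d, a + b, a + c, a + d, b + c, b + d, c + d,
     a - b, a - c, a - d, b - c, b - d, c - d}"
    by (simp add: lines_def vectors_def)
  then show ?thesis
    by (blast dest: line_of_eqD)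
qed

lemma unlonely_plus:
  assumes "unlonely a b c d"
  shows "\<exists>v \<in> {a, b, c, d, a + c, a + d, b + c, b + d, c + d,
     a - b, a - c, a - d, b - c, b - d, c - d}. det2 (a + b) v = 0"
proof -
  define R where "R = {#a, b, c, d, a + c, a + d, b + c, b + d, c + d,
     a - b, a - c, a - d, b - c, b - d, c - d#}"
  have eq: "lines a b c d = add_mset (line_of (a + b)) (image_mset line_of R)"
    by (simp add: lines_def vectors_def R_def)
  have "line_of (a + b) \<in># image_mset line_of R"
    using assms unfolding unlonely_def eq by simp
  then obtain v where v: "v \<in># R" "line_of (a + b) = line_of v"
    by auto
  have "v \<in> {a, b, c, d, a + c, a + d, b + c, b + d, c + d,
     a - b, a - c, a - d, b - c, b - d, c - d}"
    using v(1) by (simp add: R_def)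
  then show ?thesis
    using line_of_eqD[OF v(2)] by blast
qed

section \<open>Configurations with two parallel vectors\<close>

text \<open>
  A partner of \<open>c + b\<close> forces \<open>det2 c d \<le> - k (w - y)\<close>, and a partner of \<open>c - b\<close> forces
  \<open>det2 c d \<ge> k (w - y)\<close>, where \<open>y = det2 a c \<le> w = det2 a d\<close>.
\<close>

lemma not_unlonely_if_scaleR_ordered:
  assumes "unlonely a b c d" and b: "b = k *\<^sub>R a" and k: "k > 1"
    and y: "det2 a c > 0" and w: "det2 a d \<ge> det2 a c" and cd: "c \<noteq> d"
  shows False
proof -
  define y w D where "y = det2 a c" "w = det2 a d" "D = det2 c d"
  have yw: "0 < y" "y \<le> w" using y w by (simp_all add: y_w_D_def)
  have ca: "det2 c a = - y" "det2 d a = - w" "det2 d c = - D"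
    "det2 a c = y" "det2 a d = w" "det2 c d = D"
    using det2_commute[of a c] det2_commute[of a d] det2_commute[of c d] by (simp_all add: y_w_D_def)
  have kyw: "k * y > y" "k * w > w" "k * y \<le> k * w"
    using k yw by simp_all
  \<comment> \<open>This order makes \<open>c + b\<close> the sum treated by
    \<open>unlonely_plus\<close>. Candidates without \<open>d\<close> are ruled out by
    \<open>k > 1\<close> and \<open>y > 0\<close>; each of the others fixes \<open>D\<close> at a
    value within the bound.\<close>
  have "unlonely c b a d"
    using assms(1) by (metis unlonely_swap12 unlonely_swap23)
  from unlonely_plus[OF this] have 1: "D \<le> - (k * w - k * y)"
    by (simp add: b ca algebra_simps) (use yw kyw k in \<open>elim disjE; linarith\<close>)
  have "unlonely c (- b) a d"
    using \<open>unlonely c b a d\<close> by (simp add: unlonely_minus2)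
  from unlonely_plus[OF this] have 2: "k * w - k * y \<le> D"
    by (simp add: b ca algebra_simps) (use yw kyw k in \<open>elim disjE; linarith\<close>)
  \<comment> \<open>The two bounds on \<open>D\<close> are opposite, so both collapse to zero. Then
    \<open>d = l *\<^sub>R c\<close>, and equal determinants with \<open>a\<close> force
    \<open>l = 1\<close>, against \<open>c \<noteq> d\<close>.\<close>
  have "k * y = k * w" using 1 2 kyw(3) by linarith
  then have eq: "y = w" using k by simp
  then have D: "D = 0" using 1 2 by simp
  have "c \<noteq> 0" using yw by (auto simp: y_w_D_def)
  then obtain l where "d = l *\<^sub>R c"
    using det2_eq_0_imp_scaleR[of c d] D by (auto simp: y_w_D_def)
  then show False using eq cd yw by (simp add: y_w_D_def)
qed


text \<open>Symmetry reduces to the ordered case: signs of \<open>c\<close> and \<open>d\<close>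
  make their determinants with \<open>a\<close> positive, a swap of \<open>c\<close> and
  \<open>d\<close> orders them, the sign of \<open>b\<close> makes \<open>k\<close> positive, and a
  swap of \<open>a\<close> and \<open>b\<close> inverts \<open>k\<close>.\<close>

lemma not_unlonely_if_scaleR:
  assumes "unlonely a b c d" and b: "b = k *\<^sub>R a" and k: "\<bar>k\<bar> \<noteq> 1" "k \<noteq> 0"
    and c: "det2 a c \<noteq> 0" and d: "det2 a d \<noteq> 0" and cd: "c \<noteq> d" "c \<noteq> - d" 
  shows False
proof -
  have 1: False if "unlonely a b c d" "b = k *\<^sub>R a" "k > 1" "det2 a c > 0" "det2 a d > 0"
    "c \<noteq> d" for a b c d k
  proof (cases "det2 a c \<le> det2 a d")
    case True
    then show False using not_unlonely_if_scaleR_ordered that by blast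
  next
    case False
    then have "det2 a d \<le> det2 a c" "unlonely a b d c"
      using that(1) by (simp_all add: unlonely_swap34[of a b d c])
    then show False using not_unlonely_if_scaleR_ordered that by metis
  qed
  have 2: False if "unlonely a b c d" "b = k *\<^sub>R a" "k > 1" "det2 a c \<noteq> 0" "det2 a d \<noteq> 0"
    "c \<noteq> d" "c \<noteq> - d" for a b c d k
  proof -
    define c' where "c' = (if det2 a c > 0 then c else - c)"
    define d' where "d' = (if det2 a d > 0 then d else - d)"
    have "unlonely a b c' d'" "det2 a c' > 0" "det2 a d' > 0"
      using that(1,4,5) by (auto simp: c'_def d'_def unlonely_minus3 unlonely_minus4)
    moreover have "c' \<noteq> d'"
      using that(6,7) by (auto simp: c'_def d'_def)
    ultimately show False using 1 that by blast
  qed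
  have 3: False if "unlonely a b c d" "b = k *\<^sub>R a" "\<bar>k\<bar> > 1" "det2 a c \<noteq> 0" "det2 a d \<noteq> 0"
    "c \<noteq> d" "c \<noteq> - d" for a b c d k
  proof (cases "k > 1")
    case True
    then show False using 2 that by blast
  next
    case False
    then have "- k > 1" "- b = (- k) *\<^sub>R a" "unlonely a (- b) c d"
      using that by (simp_all add: unlonely_minus2)
    then show False using 2 that by blast
  qed
  show False
  proof (cases "\<bar>k\<bar> > 1")
    case True
    then show False using 3 assms by blast
  next
    case False
    have "unlonely b a c d"
      using assms(1) by (simp add: unlonely_swap12)
    moreover have "a = inverse k *\<^sub>R b"
      using k by (simp add: b)
    moreover have "\<bar>inverse k\<bar> > 1"
      unfolding abs_inverse using False k by (intro one_less_inverse) linarith+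
    moreover have "det2 b c \<noteq> 0" "det2 b d \<noteq> 0"
      using b k c d by simp_all
    ultimately show False
      using 3 cd by blast
  qed
qed

lemma not_unlonely_if_det2_eq_0:
  assumes unl: "unlonely a b c d" and ab: "det2 a b = 0" and c: "det2 a c \<noteq> 0"
    and nz: "a \<noteq> 0" "b \<noteq> 0" "d \<noteq> 0"
    and ne: "a \<noteq> b" "a \<noteq> - b" "c \<noteq> d" "c \<noteq> - d" "a \<noteq> d" "a \<noteq> - d" "b \<noteq> d" "b \<noteq> - d"
  shows False
proof -
  obtain k where k: "b = k *\<^sub>R a" using ab nz det2_eq_0_imp_scaleR by blast
  have k': "k \<noteq> 0" "k \<noteq> 1" "k \<noteq> -1" using nz ne k by auto
  show False
  proof (cases "det2 a d = 0")
    case True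
    then obtain l where l: "d = l *\<^sub>R a" using nz det2_eq_0_imp_scaleR by blast
    have l': "l \<noteq> 0" "l \<noteq> 1" "l \<noteq> -1" "l \<noteq> k" "l \<noteq> - k" using nz ne l k by auto
    \<comment> \<open>With \<open>a\<close>, \<open>b\<close>, \<open>d\<close> on one line,
      \<open>c\<close> itself is lonely: every candidate partner is a multiple of \<open>c\<close>
      plus \<open>t *\<^sub>R a\<close>, where \<open>t\<close> is, up to sign, one of
      \<open>1\<close>, \<open>k\<close>, \<open>l\<close> or a sum or difference of two of them,
      hence nonzero.\<close>
    have "det2 c a \<noteq> 0" using c det2_commute[of a c] by simp
    then have coeff: "s * det2 c a + t * det2 c a = 0 \<longleftrightarrow> s + t = 0" for s t
      by (simp flip: distrib_right)
    have coeff1: "det2 c a + t * det2 c a = 0 \<longleftrightarrow> t + 1 = 0" for t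
      using coeff[of 1 t] by (simp add: add.commute)
    have "unlonely c a b d"
      using unl by (metis unlonely_swap12 unlonely_swap23)
    from unlonely_single[OF this] show False
      using \<open>det2 c a \<noteq> 0\<close> coeff1 l' k'
      by (auto simp: k l eq_neg_iff_add_eq_0 simp flip: distrib_right left_diff_distrib)
  next
    case False
    have "\<bar>k\<bar> \<noteq> 1" using k' by linarith
    then show False
      by (rule not_unlonely_if_scaleR[OF unl k _ k'(1) c False ne(3,4)])
  qed
qed

section \<open>Pairwise non-parallel vectors in angular order\<close>

text \<open>The vectors lie in counterclockwise order within an open half-plane.\<close>

definition ordered4 :: "real^2 \<Rightarrow> real^2 \<Rightarrow> real^2 \<Rightarrow> real^2 \<Rightarrow> bool" where
  "ordered4 a b c d \<longleftrightarrow> det2 a b > 0 \<and> det2 a c > 0 \<and> det2 a d > 0 \<and>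
     det2 b c > 0 \<and> det2 b d > 0 \<and> det2 c d > 0"

lemma ordered4_rotate: "ordered4 a b c d \<Longrightarrow> ordered4 b c d (- a)"
  using det2_commute[of a b] det2_commute[of a c] det2_commute[of a d]
  by (simp add: ordered4_def)

text \<open>All other candidates have a determinant with \<open>a\<close> of known strict
  sign.\<close>

lemma ordered4_single:
  assumes "ordered4 a b c d" "unlonely a b c d"
  shows "det2 a (b - c) = 0 \<or> det2 a (b - d) = 0 \<or> det2 a (c - d) = 0"
  using unlonely_single[OF assms(2)] assms(1) by (auto simp: ordered4_def)

text \<open>The pairs arise because \<open>(b - c) + (a + c)\<close> and
  \<open>(a + d) + (b - d)\<close> both equal \<open>a + b\<close>: if one summand is parallel to
  it, so is the other. Recording both lets uniqueness of partners exclude these cases.\<close>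

lemma ordered4_plus:
  assumes "ordered4 a b c d" "unlonely a b c d"
  shows "det2 (a + b) (c - d) = 0 \<or>
    (det2 (a + b) (b - c) = 0 \<and> det2 (a + b) (a + c) = 0) \<or>
    (det2 (a + b) (a + d) = 0 \<and> det2 (a + b) (b - d) = 0)"
  using unlonely_plus[OF assms(2)] assms(1) det2_commute[of a b]
  by (auto simp: ordered4_def)

text \<open>Pigeonhole: elements of \<open>A\<close> sharing a nonzero partner would be parallel, so
  choosing partners is injective, and the cardinality bound makes it a bijection onto
  \<open>B\<close>.\<close>

lemma unique_parallel_partner:
  assumes fin: "finite A" "finite B" and card: "card B \<le> card A"
    and A: "\<And>u v. u \<in> A \<Longrightarrow> v \<in> A \<Longrightarrow> u \<noteq> v \<Longrightarrow> det2 u v \<noteq> 0"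
    and B: "0 \<notin> B"
    and ex: "\<And>u. u \<in> A \<Longrightarrow> \<exists>v\<in>B. det2 u v = 0"
  shows "card B = card A"
    and "u \<in> A \<Longrightarrow> v \<in> B \<Longrightarrow> w \<in> B \<Longrightarrow> det2 u v = 0 \<Longrightarrow> det2 u w = 0 \<Longrightarrow> v = w"
proof -
  obtain f where f: "\<And>u. u \<in> A \<Longrightarrow> f u \<in> B" "\<And>u. u \<in> A \<Longrightarrow> det2 u (f u) = 0"
    using ex by metis
  have eq: "u = u'" if "u \<in> A" "u' \<in> A" "det2 u (f u') = 0" for u u'
  proof -
    have "det2 (f u') u' = 0" using f(2)[OF that(2)] det2_commute[of "f u'" u'] by simp
    then have "det2 u u' = 0"
      using that f(1) B by (metis det2_eq_0_trans)
    then show ?thesis using A that by blast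
  qed
  have inj: "inj_on f A" using eq f by (metis inj_onI)
  have sub: "f ` A \<subseteq> B" using f by blast
  show card_eq: "card B = card A"
    using card_inj_on_le[OF inj sub fin(2)] card by simp
  have B_eq: "f ` A = B"
    using card_subset_eq[OF fin(2) sub] card_image[OF inj] card_eq by simp
  have partner: "v = f u" if "u \<in> A" "v \<in> B" "det2 u v = 0" for u v
    using that B_eq eq by blast
  show "v = w" if "u \<in> A" "v \<in> B" "w \<in> B" "det2 u v = 0" "det2 u w = 0"
    using partner that by metis
qed

lemma det2_sorted_distinct: "sorted_wrt (\<lambda>u v. det2 u v > 0) xs \<Longrightarrow> distinct xs"
  by (induction xs) auto

lemma det2_sorted_nonzero:
  assumes "sorted_wrt (\<lambda>u v. det2 u v > 0) xs" "u \<in> set xs" "v \<in> set xs" "u \<noteq> v"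
  shows "det2 u v \<noteq> 0"
  using assms
proof (induction xs)
  case (Cons x xs)
  then show ?case
    using det2_commute[of v u] by (cases "u = x"; cases "v = x") force+
qed simp

text \<open>The other two alternatives of \<open>ordered4_plus\<close> would give
  \<open>a + b\<close> two distinct partners in \<open>B\<close>.\<close>

lemma ordered4_plus_parallel:
  assumes ord: "ordered4 a b c d" and unl: "unlonely a b c d"
  shows "det2 (a + b) (c - d) = 0"
proof -
  \<comment> \<open>\<open>A\<close> runs through eight of the sixteen vectors by angle, with
    \<open>d - a\<close> in place of \<open>a - d\<close>; \<open>B\<close> holds the other
    eight.\<close>
  define A where "A = [a, a + b, b, b + c, c, c + d, d, d - a]"
  define B where "B = [a - b, b - c, c - d, a + d, a - c, b - d, a + c, b + d]"
  have ord1: "ordered4 b c d (- a)" "ordered4 c d (- a) (- b)" "ordered4 d (- a) (- b) (- c)"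
    using ord ordered4_rotate by blast+
  have unl1: "unlonely b c d (- a)" "unlonely c d (- a) (- b)" "unlonely d (- a) (- b) (- c)"
    using unl by (simp_all add: unlonely_rotate)
  note comm = det2_commute[of a b] det2_commute[of a c] det2_commute[of a d]
    det2_commute[of b c] det2_commute[of b d] det2_commute[of c d]
  have sorted: "sorted_wrt (\<lambda>u v. det2 u v > 0) A"
    using ord comm by (simp add: A_def ordered4_def)
  note A = det2_sorted_nonzero[OF sorted]
  have "distinct A"
    by (rule det2_sorted_distinct[OF sorted])
  then have cardA: "card (set A) = 8"
    by (simp add: distinct_card) (simp add: A_def)
  have cardB: "card (set B) \<le> 8"
    using card_length[of B] by (simp add: B_def)
  have B0: "0 \<notin> set B"
  proof
    assume "0 \<in> set B"
    \<comment> \<open>The zero vector satisfies all three equations, but each entry of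
      \<open>B\<close> as written violates at least one.\<close>
    then have "\<exists>v\<in>set B. det2 a v = 0 \<and> det2 b v = 0 \<and> det2 c v = 0"
      by (intro bexI[of _ 0]) simp_all
    then show False
      using ord comm by (auto simp: B_def ordered4_def)
  qed
  \<comment> \<open>The angular constraints for the four rotations give each entry of
    \<open>A\<close> a partner in \<open>B\<close>, after adjusting signs.\<close>
  have p1: "\<exists>v\<in>{b - c, b - d, c - d}. det2 a v = 0"
    using ordered4_single[OF ord unl] unfolding det2_simps bex_simps by (smt (verit))
  have p2: "\<exists>v\<in>{c - d, a + c, a + d}. det2 b v = 0"
    using ordered4_single[OF ord1(1) unl1(1)] unfolding det2_simps bex_simps by (smt (verit))
  have p3: "\<exists>v\<in>{a + d, b + d, a - b}. det2 c v = 0"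
    using ordered4_single[OF ord1(2) unl1(2)] unfolding det2_simps bex_simps by (smt (verit))
  have p4: "\<exists>v\<in>{a - b, a - c, b - c}. det2 d v = 0"
    using ordered4_single[OF ord1(3) unl1(3)] unfolding det2_simps bex_simps by (smt (verit))
  have p5: "\<exists>v\<in>{b - c, c - d, a + d}. det2 (a + b) v = 0"
    using ordered4_plus[OF ord unl] unfolding det2_simps bex_simps by (smt (verit))
  have p6: "\<exists>v\<in>{c - d, a - b, a + d}. det2 (b + c) v = 0"
    using ordered4_plus[OF ord1(1) unl1(1)] unfolding det2_simps bex_simps by (smt (verit))
  have p7: "\<exists>v\<in>{a + d, b - c, a - b}. det2 (c + d) v = 0"
    using ordered4_plus[OF ord1(2) unl1(2)] unfolding det2_simps bex_simps by (smt (verit))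
  have p8: "\<exists>v\<in>{a - b, b - c, c - d}. det2 (d - a) v = 0"
    using ordered4_plus[OF ord1(3) unl1(3)] unfolding det2_simps bex_simps by (smt (verit))
  have mono: "\<exists>v\<in>set B. det2 u v = 0" if "\<exists>v\<in>C. det2 u v = 0" "C \<subseteq> set B" for C u
    using that by blast
  have sub: "{b - c, b - d, c - d} \<subseteq> set B" "{c - d, a + c, a + d} \<subseteq> set B"
    "{a + d, b + d, a - b} \<subseteq> set B" "{a - b, a - c, b - c} \<subseteq> set B"
    "{b - c, c - d, a + d} \<subseteq> set B" "{c - d, a - b, a + d} \<subseteq> set B"
    "{a + d, b - c, a - b} \<subseteq> set B" "{a - b, b - c, c - d} \<subseteq> set B"
    unfolding B_def list.set by blast+
  have ex: "\<exists>v\<in>set B. det2 u v = 0" if "u \<in> set A" for u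
    using that mono[OF p1 sub(1)] mono[OF p2 sub(2)] mono[OF p3 sub(3)] mono[OF p4 sub(4)]
      mono[OF p5 sub(5)] mono[OF p6 sub(6)] mono[OF p7 sub(7)] mono[OF p8 sub(8)]
    unfolding A_def list.set by blast
  note partner = unique_parallel_partner[of "set A" "set B", OF _ _ _ A B0 ex]
  have "distinct B" \<comment> \<open>so that \<open>a + b\<close> cannot be parallel to two entries of \<open>B\<close>\<close>
    using partner(1) cardA cardB by (intro card_distinct) (simp add: B_def)
  then have ne: "b - c \<noteq> a + c" "a + d \<noteq> b - d"
    by (auto simp: B_def)
  have "a + b \<in> set A" by (simp add: A_def)
  then have uniq: "v = w" if "v \<in> set B" "w \<in> set B" "det2 (a + b) v = 0" "det2 (a + b) w = 0" for v w
    using partner(2)[of "a + b" v w] that cardA cardB by auto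
  show ?thesis
    using ordered4_plus[OF ord unl] ne uniq[of "b - c" "a + c"] uniq[of "a + d" "b - d"]
    by (auto simp: B_def)
qed

text \<open>Since \<open>b - c\<close> is parallel to \<open>d - a\<close> and \<open>c - d\<close>
  to \<open>a + b\<close>, the other two alternatives of \<open>ordered4_single\<close> would make
  \<open>a\<close> parallel to \<open>d\<close> or to \<open>b\<close>.\<close>

lemma ordered4_single_parallel:
  assumes ord: "ordered4 a b c d" and unl: "unlonely a b c d"
  shows "det2 a (b - d) = 0"
proof -
  have nz: "b - c \<noteq> 0" "c - d \<noteq> 0" using ord by (auto simp: ordered4_def)
  have "ordered4 d (- a) (- b) (- c)" 
    using ord ordered4_rotate by blast
  moreover have "unlonely d (- a) (- b) (- c)"
    using unl by (simp add: unlonely_rotate)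
  ultimately have da: "det2 (b - c) (d - a) = 0"
    using ordered4_plus_parallel[of d "- a" "- b" "- c"] det2_commute[of "b - c" "d - a"] by simp
  have ab: "det2 (c - d) (a + b) = 0"
    using ordered4_plus_parallel[OF ord unl] det2_commute[of "c - d" "a + b"] by simp
  show ?thesis
    using ordered4_single[OF ord unl] det2_eq_0_trans[OF _ da nz(1), of a]
      det2_eq_0_trans[OF _ ab nz(2), of a] ord
    by (auto simp: ordered4_def)
qed

text \<open>The value \<open>det2 a d\<close> counts as consecutive, being
  \<open>det2 d (- a)\<close>.\<close>

lemma ordered4_sqrt2:
  assumes ord: "ordered4 a b c d" and unl: "unlonely a b c d"
  shows "(det2 a c / det2 a b)\<^sup>2 = 2"
proof -
  have "det2 a b = det2 a d"
    using ordered4_single_parallel[OF ord unl] by simp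
  moreover have "ordered4 b c d (- a)" "ordered4 c d (- a) (- b)"
    using ord ordered4_rotate by blast+
  moreover have "unlonely b c d (- a)" "unlonely c d (- a) (- b)"
    using unl by (simp_all add: unlonely_rotate)
  ultimately have "det2 b c = det2 a b" "det2 c d = det2 a b" "det2 a d = det2 a b"
    using ordered4_single_parallel[of b c d "- a"] ordered4_single_parallel[of c d "- a" "- b"]
      det2_commute[of a b] det2_commute[of b c] by simp_all
  moreover from this have "det2 b d = det2 a c"
    using ordered4_plus_parallel[OF ord unl] by simp
  ultimately show ?thesis
    using det2_Pluecker[of a b c d] ord
    by (simp add: ordered4_def power2_eq_square field_simps)
qed

lemma unlonely_imp_ordered4:
  assumes unl: "unlonely a b c d"
    and nz: "det2 a b \<noteq> 0" "det2 a c \<noteq> 0" "det2 a d \<noteq> 0" "det2 b c \<noteq> 0" "det2 b d \<noteq> 0" "det2 c d \<noteq> 0"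
  obtains b' c' d' where "ordered4 a b' c' d'" "unlonely a b' c' d'"
    "{b', c', d'} \<subseteq> {b, c, d} \<union> uminus ` {b, c, d}"
proof -
  define b1 where "b1 = (if det2 a b > 0 then b else - b)"
  define c1 where "c1 = (if det2 a c > 0 then c else - c)"
  define d1 where "d1 = (if det2 a d > 0 then d else - d)"
  have unl1: "unlonely a b1 c1 d1"
    using unl by (auto simp: b1_def c1_def d1_def unlonely_minus2 unlonely_minus3 unlonely_minus4)
  have sub: "{b1, c1, d1} \<subseteq> {b, c, d} \<union> uminus ` {b, c, d}"
    by (auto simp: b1_def c1_def d1_def)
  have pos: "det2 a b1 > 0" "det2 a c1 > 0" "det2 a d1 > 0"
    and ne: "det2 b1 c1 \<noteq> 0" "det2 b1 d1 \<noteq> 0" "det2 c1 d1 \<noteq> 0"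
    using nz by (auto simp: b1_def c1_def d1_def)
  note comm = det2_commute[of b1 c1] det2_commute[of b1 d1] det2_commute[of c1 d1]
  \<comment> \<open>A cyclic orientation of \<open>b1\<close>, \<open>c1\<close>, \<open>d1\<close>
    would give all three terms of the Pluecker relation the same sign. What remains is a linear
    order, one of six.\<close>
  have "\<not> (det2 b1 c1 > 0 \<and> det2 c1 d1 > 0 \<and> det2 b1 d1 < 0)"
    "\<not> (det2 b1 c1 < 0 \<and> det2 c1 d1 < 0 \<and> det2 b1 d1 > 0)"
    using det2_Pluecker[of a b1 c1 d1] pos
    by (smt (verit) mult_pos_pos mult_pos_neg)+
  then have "ordered4 a b1 c1 d1 \<or> ordered4 a b1 d1 c1 \<or> ordered4 a c1 b1 d1 \<or>
    ordered4 a c1 d1 b1 \<or> ordered4 a d1 b1 c1 \<or> ordered4 a d1 c1 b1"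
    using pos ne comm unfolding ordered4_def by (smt (verit))
  moreover have "unlonely a b1 d1 c1" "unlonely a c1 b1 d1" "unlonely a c1 d1 b1"
    "unlonely a d1 b1 c1" "unlonely a d1 c1 b1"
    using unl1 by (metis unlonely_swap23 unlonely_swap34)+
  ultimately show ?thesis
    using that sub unl1 by blast
qed

section \<open>Rationality and the return to the multiset\<close>

lemma rational_square_neq_2:
  assumes "x \<in> \<rat>"
  shows "x\<^sup>2 \<noteq> (2::real)"
proof
  assume x: "x\<^sup>2 = 2"
  obtain m n :: nat where n: "n \<noteq> 0" and mn: "\<bar>x\<bar> = real m / real n" and cop: "coprime m n"
    using Rats_abs_nat_div_natE[OF assms] .
  have "real m = \<bar>x\<bar> * real n" using mn n by simp
  then have "real (m\<^sup>2) = real (2 * n\<^sup>2)"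
    using x by (simp add: power_mult_distrib)
  then have eq: "m\<^sup>2 = 2 * n\<^sup>2" by linarith
  then have "even m" by (metis dvd_triv_left even_power)
  then obtain k where "m = 2 * k" by blast
  then have "n\<^sup>2 = 2 * k\<^sup>2" using eq by (simp add: power2_eq_square)
  then have "even n" by (metis dvd_triv_left even_power)
  then show False using \<open>even m\<close> cop by (meson coprime_common_divisor odd_one)
qed

lemma not_unlonely:
  assumes nz: "a \<noteq> 0" "b \<noteq> 0" "c \<noteq> 0" "d \<noteq> 0"
    and ne: "a \<noteq> b" "a \<noteq> - b" "a \<noteq> c" "a \<noteq> - c" "a \<noteq> d" "a \<noteq> - d"
      "b \<noteq> c" "b \<noteq> - c" "b \<noteq> d" "b \<noteq> - d" "c \<noteq> d" "c \<noteq> - d"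
    and nonpar: "det2 a b \<noteq> 0 \<or> det2 a c \<noteq> 0 \<or> det2 a d \<noteq> 0"
    and rat: "\<And>v i. v \<in> {a, b, c, d} \<Longrightarrow> v $ i \<in> \<rat>"
  shows "\<not> unlonely a b c d"
proof
  assume unl: "unlonely a b c d"
  have ne': "b \<noteq> a" "b \<noteq> - a" "c \<noteq> a" "c \<noteq> - a" "d \<noteq> a" "d \<noteq> - a"
      "c \<noteq> b" "c \<noteq> - b" "d \<noteq> b" "d \<noteq> - b" "d \<noteq> c" "d \<noteq> - c"
    using ne by (auto simp: equation_minus_iff)
  have unl': "unlonely a b d c" "unlonely a c b d" "unlonely a c d b" "unlonely a d b c"
    "unlonely a d c b" "unlonely b c a d" "unlonely b d a c" "unlonely c d a b"
    using unl by (metis unlonely_swap12 unlonely_swap23 unlonely_swap34)+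
  \<comment> \<open>If \<open>a\<close> and \<open>b\<close> were parallel, \<open>nonpar\<close>
    would make \<open>c\<close> or \<open>d\<close> the transversal vector, hence two instances.
    From \<open>4\<close> on, \<open>a\<close> is the transversal.\<close>
  have 1: "det2 a b \<noteq> 0"
    using not_unlonely_if_det2_eq_0[of a b c d] not_unlonely_if_det2_eq_0[of a b d c]
      unl unl' nz ne ne' nonpar by blast
  have 2: "det2 a c \<noteq> 0"
    using not_unlonely_if_det2_eq_0[of a c b d] not_unlonely_if_det2_eq_0[of a c d b]
      unl unl' nz ne ne' nonpar by blast
  have 3: "det2 a d \<noteq> 0"
    using not_unlonely_if_det2_eq_0[of a d b c] not_unlonely_if_det2_eq_0[of a d c b]
      unl unl' nz ne ne' nonpar by blast
  have 4: "det2 b c \<noteq> 0"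
    using not_unlonely_if_det2_eq_0[of b c a d] 1 2 3 det2_commute[of a b] unl' nz ne ne'
    by auto
  have 5: "det2 b d \<noteq> 0"
    using not_unlonely_if_det2_eq_0[of b d a c] 1 2 3 det2_commute[of a b] unl' nz ne ne'
    by auto
  have 6: "det2 c d \<noteq> 0"
    using not_unlonely_if_det2_eq_0[of c d a b] 1 2 3 det2_commute[of a c] unl' nz ne ne'
    by auto
  obtain b' c' d' where ord: "ordered4 a b' c' d'" "unlonely a b' c' d'"
    "{b', c', d'} \<subseteq> {b, c, d} \<union> uminus ` {b, c, d}"
    using unlonely_imp_ordered4[OF unl 1 2 3 4 5 6] .
  have "v $ i \<in> \<rat>" if "v \<in> {a, b', c', d'}" for v i
  proof -
    obtain w where "w \<in> {a, b, c, d}" "v = w \<or> v = - w"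
      using \<open>v \<in> {a, b', c', d'}\<close> ord(3) by blast
    then show ?thesis using rat[of w i] by auto
  qed
  then have "det2 a c' / det2 a b' \<in> \<rat>"
    by (simp add: det2_def)
  then show False
    using ordered4_sqrt2[OF ord(1,2)] rational_square_neq_2 by blast
qed

lemma mset_set_index_pairs_4:
  "mset_set (index_pairs 4) = {#(1, 2), (1, 3), (1, 4), (2, 3), (2, 4), (3, 4)#}"
proof -
  have "index_pairs 4 = {(1, 2), (1, 3), (1, 4), (2, 3), (2, 4), (3, 4)}"
    by (auto simp: index_pairs_def)
  then show ?thesis by simp
qed

lemma S_multiset_4: "S_multiset 4 p = vectors (p 1) (p 2) (p 3) (p 4)"
proof -
  have "{1..4} = {1, 2, 3, 4::nat}" by auto
  then have "mset_set {1..4} = {#1, 2, 3, 4::nat#}" by simp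
  then show ?thesis
    by (simp add: S_multiset_def mset_set_index_pairs_4 vectors_def)
qed

text \<open>As no vector is zero, a parallel partner spans the same line, and removing one vector
  removes just one copy of that line.\<close>

lemma not_lonely_imp_unlonely:
  assumes "\<not> lonely_vector_property 4 p"
    and nz: "0 \<notin># S_multiset 4 p"
  shows "unlonely (p 1) (p 2) (p 3) (p 4)"
  unfolding unlonely_def
proof
  define S where "S = S_multiset 4 p"
  have lines: "lines (p 1) (p 2) (p 3) (p 4) = image_mset line_of S"
    by (simp add: lines_def S_def S_multiset_4)
  fix L assume "L \<in># lines (p 1) (p 2) (p 3) (p 4)"
  then obtain v where v: "v \<in># S" "L = line_of v"
    unfolding lines by auto
  then obtain w where w: "w \<in># S - {#v#}" "det2 v w = 0"
    using assms(1) unfolding lonely_vector_property_def S_def parallel_iff_det2 by blast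
  have "line_of w = L"
    using line_of_eqI[OF w(2)] v w(1) nz unfolding S_def by (metis in_diffD)
  moreover have "image_mset line_of (S - {#v#}) = image_mset line_of S - {#L#}"
    using v by (simp add: image_mset_Diff)
  ultimately show "L \<in># lines (p 1) (p 2) (p 3) (p 4) - {#L#}"
    using w(1) unfolding lines by (metis image_eqI set_image_mset)
qed

theorem proposition4p4:
  fixes p :: "nat \<Rightarrow> real^2"
  assumes rational: "\<And>i k. i \<in> {1..4} \<Longrightarrow> p i $ k \<in> \<rat>"
    and nonzero: "\<And>i. i \<in> {1..4} \<Longrightarrow> p i \<noteq> 0"
    and not_all_parallel: "\<not> (\<forall>i\<in>{1..4}. \<forall>j\<in>{1..4}. parallel (p i) (p j))"
    and no_two_equal_or_opposite:
      "\<And>i j. i \<in> {1..4} \<Longrightarrow> j \<in> {1..4} \<Longrightarrow> i \<noteq> j \<Longrightarrow> p i \<noteq> p j \<and> p i \<noteq> - p j"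
  shows "lonely_vector_property 4 p"
proof (rule ccontr)
  assume not_lonely: "\<not> lonely_vector_property 4 p"
  have nz: "p 1 \<noteq> 0" "p 2 \<noteq> 0" "p 3 \<noteq> 0" "p 4 \<noteq> 0"
    using nonzero by simp_all
  have ne: "p 1 \<noteq> p 2" "p 1 \<noteq> - p 2" "p 1 \<noteq> p 3" "p 1 \<noteq> - p 3" "p 1 \<noteq> p 4" "p 1 \<noteq> - p 4"
    "p 2 \<noteq> p 3" "p 2 \<noteq> - p 3" "p 2 \<noteq> p 4" "p 2 \<noteq> - p 4" "p 3 \<noteq> p 4" "p 3 \<noteq> - p 4"
    by (simp_all add: no_two_equal_or_opposite)
  have "0 \<notin># S_multiset 4 p"
    using nz ne by (auto simp: S_multiset_4 vectors_def eq_neg_iff_add_eq_0)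
  then have "unlonely (p 1) (p 2) (p 3) (p 4)"
    by (rule not_lonely_imp_unlonely[OF not_lonely])
  moreover have "det2 (p 1) (p 2) \<noteq> 0 \<or> det2 (p 1) (p 3) \<noteq> 0 \<or> det2 (p 1) (p 4) \<noteq> 0"
  \<comment> \<open>Otherwise all vectors are parallel to the nonzero \<open>p 1\<close>, hence to
    each other.\<close>
  proof (rule ccontr)
    assume "\<not> ?thesis"
    moreover have "i \<in> {1..4} \<Longrightarrow> i = 1 \<or> i = 2 \<or> i = 3 \<or> i = 4" for i :: nat
      by auto
    ultimately have "det2 (p 1) (p i) = 0" if "i \<in> {1..4}" for i
      using that by (metis det2_simps(1))
    then have "det2 (p i) (p j) = 0" if "i \<in> {1..4}" "j \<in> {1..4}" for i j
      using that nz(1) det2_eq_0_trans[of "p i" "p 1" "p j"] det2_commute[of "p 1" "p i"] by simp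
    then show False
      using not_all_parallel by (simp add: parallel_iff_det2)
  qed
  moreover have "v $ i \<in> \<rat>" if "v \<in> {p 1, p 2, p 3, p 4}" for v i
    using that rational by auto
  ultimately show False
    using not_unlonely nz ne by blast
qed

end
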